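(* For any integer $\gamma \geq 0$, as a set-operad, the underlying set of $\mathsf{Dias}_\gamma$ is the set of all words on the alphabet $\{0, 1, \dots, \gamma\}$ containing exactly one occurrence of $0$.
   Context: Write $[\gamma] = \{1, \dots, \gamma\}$. Operads are nonsymmetric, described by partial compositions $\circ_i$ and a unit; a set-operad is a nonsymmetric operad in sets. For a monoid $(\mathcal{M}, \bullet, 1)$, $\mathsf{T}\mathcal{M}$ is the set-operad whose elements of arity $n \geq 1$ are the words $u_1 \dots u_n$ of length $n$ on $\mathcal{M}$, with partial compositions $u \circ_i v := u_1 \dots u_{i-1}\,(u_i \bullet v_1) \dots (u_i \bullet v_m)\, u_{i+1} \dots u_n$ for $u$ of length $n$, $v$ of length $m$, $1 \le i \le n$, and with unit the one-letter word $1$. Let $\mathcal{M}_\gamma$ be the monoid on $\{0\} \cup [\gamma]$ with product $\max$ (whose unit is $0$). $\mathsf{Dias}_\gamma$ is the suboperad of $\mathsf{T}\mathcal{M}_\gamma$ generated by the set of two-letter words $\{0a, a0 : a \in [\gamma]\}$, i.e. the smallest set of words containing these words and the unit word $0$ and closed under all partial compositions. *)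

theory Defs
  imports "HOL-Algebra.Group"
begin

section \<open>Nonsymmetric set-operads\<close>

text \<open>The graded set of elements is given as one set together with an arity function.
  The partial composition \<open>x \<circ>\<^sub>i y\<close> is \<open>pcomp Op x i y\<close>; positions are counted from 1 and
  it is meaningful only for \<open>1 \<le> i \<le> arity Op x\<close>.\<close>

record 'a set_operad =
  elements :: "'a set"
  arity :: "'a \<Rightarrow> nat"
  pcomp :: "'a \<Rightarrow> nat \<Rightarrow> 'a \<Rightarrow> 'a"
  operad_unit :: 'a

locale nonsymmetric_operad =
  fixes Op :: "'a set_operad"
  assumes arity_pos: "x \<in> elements Op \<Longrightarrow> 1 \<le> arity Op x"
    and unit_mem: "operad_unit Op \<in> elements Op"
    and arity_unit: "arity Op (operad_unit Op) = 1"
    and pcomp_mem: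
      "\<lbrakk>x \<in> elements Op; y \<in> elements Op; 1 \<le> i; i \<le> arity Op x\<rbrakk>
        \<Longrightarrow> pcomp Op x i y \<in> elements Op"
    and arity_pcomp:
      "\<lbrakk>x \<in> elements Op; y \<in> elements Op; 1 \<le> i; i \<le> arity Op x\<rbrakk>
        \<Longrightarrow> arity Op (pcomp Op x i y) = arity Op x + arity Op y - 1"
    and unit_left: "x \<in> elements Op \<Longrightarrow> pcomp Op (operad_unit Op) 1 x = x"
    and unit_right:
      "\<lbrakk>x \<in> elements Op; 1 \<le> i; i \<le> arity Op x\<rbrakk> \<Longrightarrow> pcomp Op x i (operad_unit Op) = x"
    and sequential:
      "\<lbrakk>x \<in> elements Op; y \<in> elements Op; z \<in> elements Op;
        1 \<le> i; i \<le> arity Op x; 1 \<le> j; j \<le> arity Op y\<rbrakk>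
        \<Longrightarrow> pcomp Op (pcomp Op x i y) (i + j - 1) z = pcomp Op x i (pcomp Op y j z)"
    and parallel:
      "\<lbrakk>x \<in> elements Op; y \<in> elements Op; z \<in> elements Op;
        1 \<le> i; i < k; k \<le> arity Op x\<rbrakk>
        \<Longrightarrow> pcomp Op (pcomp Op x i y) (k + arity Op y - 1) z = pcomp Op (pcomp Op x k z) i y"

definition is_suboperad :: "'a set \<Rightarrow> 'a set_operad \<Rightarrow> bool" where
  "is_suboperad S Op \<longleftrightarrow>
     S \<subseteq> elements Op \<and> operad_unit Op \<in> S \<and>
     (\<forall>x\<in>S. \<forall>y\<in>S. \<forall>i. 1 \<le> i \<and> i \<le> arity Op x \<longrightarrow> pcomp Op x i y \<in> S)"

text \<open>The generated suboperad is intended for \<open>G \<subseteq> elements Op\<close>.\<close>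

definition generated_suboperad :: "'a set_operad \<Rightarrow> 'a set \<Rightarrow> 'a set_operad" where
  "generated_suboperad Op G = Op\<lparr>elements := \<Inter>{S. is_suboperad S Op \<and> G \<subseteq> S}\<rparr>"

lemma nonsymmetric_operad_suboperad:
  assumes "nonsymmetric_operad Op" "is_suboperad S Op"
  shows "nonsymmetric_operad (Op\<lparr>elements := S\<rparr>)"
proof -
  interpret nonsymmetric_operad Op by fact
  have S: "x \<in> S \<Longrightarrow> x \<in> elements Op" for x
    using assms(2) by (auto simp: is_suboperad_def)
  show ?thesis
    using assms(2)
    by unfold_locales
      (auto simp: is_suboperad_def arity_unit arity_pcomp S sequential[simplified]
        parallel[simplified]
        intro: arity_pos[simplified] unit_left[simplified] unit_right[simplified])
qed

lemma is_suboperad_generated: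
  assumes "nonsymmetric_operad Op" "G \<subseteq> elements Op"
  shows "is_suboperad (elements (generated_suboperad Op G)) Op"
proof -
  interpret nonsymmetric_operad Op by fact
  have "is_suboperad (elements Op) Op"
    by (auto simp: is_suboperad_def unit_mem pcomp_mem)
  with assms(2) show ?thesis
    unfolding generated_suboperad_def is_suboperad_def by simp blast
qed


section \<open>The operad of words on a monoid\<close>

text \<open>Letters are numbered from 1 in \<open>u \<circ>\<^sub>i v\<close>, so the letter of \<open>u\<close> at position \<open>i\<close> is
  \<open>u ! (i - 1)\<close>.\<close>

definition word_operad :: "('a, 'b) monoid_scheme \<Rightarrow> 'a list set_operad" where
  "word_operad M =
    \<lparr>elements = {u. u \<noteq> [] \<and> set u \<subseteq> carrier M},
     arity = length,
     pcomp = (\<lambda>u i v. take (i - 1) u @ map (\<lambda>x. u ! (i - 1) \<otimes>\<^bsub>M\<^esub> x) v @ drop i u),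
     operad_unit = [\<one>\<^bsub>M\<^esub>]\<rparr>"

definition max_monoid :: "nat \<Rightarrow> nat monoid" where
  "max_monoid \<gamma> = \<lparr>carrier = {0..\<gamma>}, mult = max, one = 0\<rparr>"

lemma monoid_max_monoid: "Group.monoid (max_monoid \<gamma>)"
  by (auto simp: max_monoid_def intro!: Group.monoidI)

lemma nonsymmetric_operad_word_operad:
  assumes "Group.monoid M"
  shows "nonsymmetric_operad (word_operad M)"
proof -
  interpret Group.monoid M by fact
  have split: "\<exists>p a s. u = p @ a # s \<and> length p = i - 1"
    if "1 \<le> i" "i \<le> length u" for u :: "'a list" and i
  proof (intro exI conjI)
    show "u = take (i - 1) u @ u ! (i - 1) # drop (Suc (i - 1)) u"
      using that by (intro id_take_nth_drop) simp
    show "length (take (i - 1) u) = i - 1"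
      using that by simp
  qed
  have comp: "pcomp (word_operad M) (p @ a # s) i v = p @ map (\<lambda>x. a \<otimes>\<^bsub>M\<^esub> x) v @ s"
    if "i = Suc (length p)" for p a s i v
    using that by (simp add: word_operad_def)
  have el: "u \<in> elements (word_operad M) \<longleftrightarrow> u \<noteq> [] \<and> set u \<subseteq> carrier M"
    and ar: "arity (word_operad M) u = length u"
    and un: "operad_unit (word_operad M) = [\<one>\<^bsub>M\<^esub>]" for u
    by (simp_all add: word_operad_def)
  show ?thesis
  proof
    fix x assume x: "x \<in> elements (word_operad M)"
    show "1 \<le> arity (word_operad M) x" using x by (cases x) (simp_all add: el ar)
    show "pcomp (word_operad M) (operad_unit (word_operad M)) 1 x = x"
      using x comp[of 1 "[]" "\<one>\<^bsub>M\<^esub>" "[]" x] by (auto simp: el un intro!: map_idI)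
    fix i assume i: "1 \<le> i" "i \<le> arity (word_operad M) x"
    then obtain p a s where ps: "x = p @ a # s" "length p = i - 1"
      using split[of i x] by (auto simp: ar)
    show "pcomp (word_operad M) x i (operad_unit (word_operad M)) = x"
      using x i ps by (simp add: comp un el)
    fix y assume y: "y \<in> elements (word_operad M)"
    show "pcomp (word_operad M) x i y \<in> elements (word_operad M)"
      using x y i ps by (auto simp: comp el)
    show "arity (word_operad M) (pcomp (word_operad M) x i y)
        = arity (word_operad M) x + arity (word_operad M) y - 1"
      using i ps by (simp add: comp ar)
    fix z assume z: "z \<in> elements (word_operad M)"
    {
      fix j assume j: "1 \<le> j" "j \<le> arity (word_operad M) y"
      then obtain q b t where qt: "y = q @ b # t" "length q = j - 1"
        using split[of j y] by (auto simp: ar)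
      have "pcomp (word_operad M) (pcomp (word_operad M) x i y) (i + j - 1) z
          = pcomp (word_operad M) ((p @ map (\<lambda>x. a \<otimes>\<^bsub>M\<^esub> x) q) @ (a \<otimes>\<^bsub>M\<^esub> b)
              # (map (\<lambda>x. a \<otimes>\<^bsub>M\<^esub> x) t @ s)) (i + j - 1) z"
        using i ps qt by (simp add: comp)
      also have "\<dots> = p @ map (\<lambda>x. a \<otimes>\<^bsub>M\<^esub> x) q @ map (\<lambda>x. (a \<otimes>\<^bsub>M\<^esub> b) \<otimes>\<^bsub>M\<^esub> x) z
          @ map (\<lambda>x. a \<otimes>\<^bsub>M\<^esub> x) t @ s"
        using i j ps qt by (subst comp) auto
      also have "\<dots> = pcomp (word_operad M) x i (pcomp (word_operad M) y j z)"
        using x y z i j ps qt by (auto simp: comp el m_assoc subset_iff)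
      finally show "pcomp (word_operad M) (pcomp (word_operad M) x i y) (i + j - 1) z
          = pcomp (word_operad M) x i (pcomp (word_operad M) y j z)" .
    }
  next
    fix x y z i k
    assume i: "1 \<le> i" and k: "i < k" "k \<le> arity (word_operad M) x"
    then obtain p a s where ps: "x = p @ a # s" "length p = i - 1"
      using split[of i x] by (auto simp: ar)
    with k have "1 \<le> k - i" "k - i \<le> length s"
      using i ps by (auto simp: ar)
    then obtain q b t where qt: "s = q @ b # t" "length q = k - i - 1"
      using split[of "k - i" s] by blast
    have "pcomp (word_operad M) (pcomp (word_operad M) x i y)
          (k + arity (word_operad M) y - 1) z
        = pcomp (word_operad M) ((p @ map (\<lambda>x. a \<otimes>\<^bsub>M\<^esub> x) y @ q) @ b # t)
          (k + arity (word_operad M) y - 1) z"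
      using i ps qt by (simp add: comp)
    also have "\<dots> = p @ map (\<lambda>x. a \<otimes>\<^bsub>M\<^esub> x) y @ q @ map (\<lambda>x. b \<otimes>\<^bsub>M\<^esub> x) z @ t"
      using i k ps qt by (subst comp) (auto simp: ar)
    also have "\<dots> = pcomp (word_operad M) (p @ a # (q @ map (\<lambda>x. b \<otimes>\<^bsub>M\<^esub> x) z @ t)) i y"
      using i ps by (subst comp) auto
    also have "p @ a # (q @ map (\<lambda>x. b \<otimes>\<^bsub>M\<^esub> x) z @ t)
        = pcomp (word_operad M) ((p @ a # q) @ b # t) k z"
      using i k ps qt by (subst comp) auto
    finally show "pcomp (word_operad M) (pcomp (word_operad M) x i y)
          (k + arity (word_operad M) y - 1) z
        = pcomp (word_operad M) (pcomp (word_operad M) x k z) i y"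
      using ps qt by simp
  qed (simp_all add: el ar un)
qed


section \<open>The operad \<open>Dias\<^sub>\<gamma>\<close>\<close>

definition Dias :: "nat \<Rightarrow> nat list set_operad" where
  "Dias \<gamma> = generated_suboperad (word_operad (max_monoid \<gamma>))
     ({[0, a] | a. a \<in> {1..\<gamma>}} \<union> {[a, 0] | a. a \<in> {1..\<gamma>}})"

lemma nonsymmetric_operad_Dias: "nonsymmetric_operad (Dias \<gamma>)"
proof -
  let ?T = "word_operad (max_monoid \<gamma>)"
  let ?G = "{[0, a] | a. a \<in> {1..\<gamma>}} \<union> {[a, 0] | a. a \<in> {1..\<gamma>}}"
  have T: "nonsymmetric_operad ?T"
    by (intro nonsymmetric_operad_word_operad monoid_max_monoid)
  have "?G \<subseteq> elements ?T"
    by (auto simp: word_operad_def max_monoid_def)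
  from nonsymmetric_operad_suboperad[OF T is_suboperad_generated[OF T this]]
  show ?thesis by (simp add: Dias_def generated_suboperad_def)
qed

end

theory Submission
  imports Defs
begin

text \<open>Composing at the letter \<open>0\<close> inserts a word unchanged, and composing at a letter
  \<open>a > 0\<close> inserts only nonzero letters, so the words with exactly one \<open>0\<close> form a suboperad.
  Conversely, composing at the unique \<open>0\<close> with \<open>b0\<close> or \<open>0b\<close> inserts \<open>b\<close> immediately to its
  left or right, and every such word arises from the unit word by these insertions.\<close>

text \<open>Splitting the word at the composed letter replaces \<open>take\<close>,
  \<open>drop\<close> and indexing by concatenation; positions count from 1, hence
  \<open>Suc (length p)\<close>.\<close>

lemma pcomp_word_operad_append:
  "pcomp (word_operad M) (p @ a # s) (Suc (length p)) v = p @ map (\<lambda>x. a \<otimes>\<^bsub>M\<^esub> x) v @ s"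
  by (simp add: word_operad_def)

text \<open>\<open>max 0\<close> is the identity on naturals, while \<open>max a\<close> with a > 0
  never takes the value 0.\<close>

lemma count_list_map_max:
  "count_list (map (max a) v) (0::nat) = (if a = 0 then count_list v 0 else 0)"
proof (cases "a = 0")
  case False
  then show ?thesis by (auto simp: count_list_0_iff max_def)
qed (simp add: map_idI)

lemma is_suboperad_one_zero:
  "is_suboperad {w. set w \<subseteq> {0..\<gamma>} \<and> count_list w 0 = 1} (word_operad (max_monoid \<gamma>))"
  (is "is_suboperad ?W ?T")
  unfolding is_suboperad_def
proof (intro conjI ballI allI impI)
  \<comment> \<open>Containing a 0 forces the word to be nonempty.\<close>
  show "?W \<subseteq> elements ?T"
    by (auto simp: word_operad_def max_monoid_def)
  show "operad_unit ?T \<in> ?W"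
    by (simp add: word_operad_def max_monoid_def)
  fix u v i
  assume u: "u \<in> ?W" and v: "v \<in> ?W" and i: "1 \<le> i \<and> i \<le> arity ?T u"
  have "u = take (i - 1) u @ u ! (i - 1) # drop (Suc (i - 1)) u"
    using i by (intro id_take_nth_drop) (auto simp: word_operad_def)
  then obtain p a s where ps: "u = p @ a # s" "i = Suc (length p)"
    using i by (intro that) (auto simp: word_operad_def)
  have "pcomp ?T u i v = p @ map (max a) v @ s"
    unfolding ps pcomp_word_operad_append by (simp add: max_monoid_def)
  \<comment> \<open>If a = 0, the only zero of the result is that of \<open>v\<close>; otherwise it
    is that of \<open>u\<close>, which lies in \<open>p\<close> or \<open>s\<close>.\<close>
  moreover have "p @ map (max a) v @ s \<in> ?W"
    using u v by (auto simp: ps count_list_map_max split: if_splits)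
  ultimately show "pcomp ?T u i v \<in> ?W" by simp
qed

text \<open>\<open>S\<close> is arbitrary because the generated suboperad is the intersection of all
  such \<open>S\<close>.\<close>

lemma one_zero_word_mem_suboperad:
  assumes S: "is_suboperad S (word_operad (max_monoid \<gamma>))"
    and right: "\<And>b. b \<in> {1..\<gamma>} \<Longrightarrow> [0, b] \<in> S"
    and left: "\<And>b. b \<in> {1..\<gamma>} \<Longrightarrow> [b, 0] \<in> S"
    and "set p \<subseteq> {1..\<gamma>}" "set s \<subseteq> {1..\<gamma>}"
  shows "p @ 0 # s \<in> S"
proof -
  have insert_at_zero: "q @ v @ t \<in> S" if "q @ 0 # t \<in> S" "v \<in> S" for q t v
  proof -
    have "pcomp (word_operad (max_monoid \<gamma>)) (q @ 0 # t) (Suc (length q)) v \<in> S"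
    proof -
      have "Suc (length q) \<le> arity (word_operad (max_monoid \<gamma>)) (q @ 0 # t)"
        by (simp add: word_operad_def)
      then show ?thesis using S that by (simp add: is_suboperad_def)
    qed
    then show ?thesis
      unfolding pcomp_word_operad_append by (simp add: max_monoid_def map_idI)
  qed
  \<comment> \<open>New letters enter next to the 0 and push earlier ones outward, so
    \<open>p\<close> grows at its end and, below, \<open>s\<close> at its head.\<close>
  have "p @ [0] \<in> S"
    using \<open>set p \<subseteq> {1..\<gamma>}\<close>
  proof (induction p rule: rev_induct)
    case Nil
    then show ?case using S by (simp add: is_suboperad_def word_operad_def max_monoid_def)
  next
    case (snoc b p)
    then show ?case using insert_at_zero[of p "[]" "[b, 0]"] left by simp
  qed
  then show ?thesis
    using \<open>set s \<subseteq> {1..\<gamma>}\<close>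
  proof (induction s)
    case (Cons b s)
    then show ?case using insert_at_zero[of p s "[0, b]"] right by simp
  qed simp
qed

theorem proposition2p1p1:
  fixes \<gamma> :: nat
  shows "elements (Dias \<gamma>) = {w. set w \<subseteq> {0..\<gamma>} \<and> count_list w 0 = 1}"
    (is "_ = ?W")
proof
  let ?G = "{[0, a] | a. a \<in> {1..\<gamma>}} \<union> {[a, 0] | a. a \<in> {1..\<gamma>}}"
  have el: "elements (Dias \<gamma>)
      = \<Inter>{S. is_suboperad S (word_operad (max_monoid \<gamma>)) \<and> ?G \<subseteq> S}"
    by (simp add: Dias_def generated_suboperad_def)
  have "?G \<subseteq> ?W" by auto
  then show "elements (Dias \<gamma>) \<subseteq> ?W"
    \<comment> \<open>\<open>?W\<close> is itself a member of the intersected family.\<close>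
    unfolding el using is_suboperad_one_zero by (intro Inter_lower) blast
  show "?W \<subseteq> elements (Dias \<gamma>)"
  proof
    fix w assume w: "w \<in> ?W"
    then have "0 \<in> set w" by (cases "0 \<in> set w") simp_all
    then obtain p s where ps: "w = p @ 0 # s" by (auto dest: split_list)
    \<comment> \<open>The displayed 0 already accounts for the whole count.\<close>
    with w have "0 \<notin> set p" "0 \<notin> set s" by (simp_all add: count_list_0_iff)
    with w ps have "set p \<subseteq> {1..\<gamma>}" "set s \<subseteq> {1..\<gamma>}"
      by (auto simp: subset_iff Suc_le_eq intro: gr0I)
    then show "w \<in> elements (Dias \<gamma>)"
      unfolding el ps by (auto intro!: one_zero_word_mem_suboperad)
  qed
qed

end
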